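(* Let $\mathcal{C}$ be a regular category (in particular finitely complete) with binary coproducts, and let $Y$ be an object of $\mathcal{C}$. If $Y$ is a Mal'tsev object in $\mathcal{C}$, then $Y$ is a W-Mal'tsev object in $\mathcal{C}$.
   Context: Relations. A relation from $X$ to $Z$ in a category $\mathcal{C}$ is a span $X\xleftarrow{r_1}R\xrightarrow{r_2}Z$ with $(r_1,r_2)$ jointly monomorphic. For morphisms $x\colon Y\to X$, $z\colon Y\to Z$ write $(x,z)\in_Y R$ if there is $w\colon Y\to R$ with $r_1w=x$ and $r_2w=z$. W-Mal'tsev object. An object $Y$ of $\mathcal{C}$ is a W-Mal'tsev object if for every relation $X\xleftarrow{r_1}R\xrightarrow{r_2}Z$ in $\mathcal{C}$ and all morphisms $x_1,x_2\colon Y\to X$, $z_1,z_2\colon Y\to Z$: if $(x_1,z_2)\in_Y R$, $(x_2,z_2)\in_Y R$ and $(x_2,z_1)\in_Y R$, then $(x_1,z_1)\in_Y R$. Mal'tsev object. Let $\mathcal{C}$ be finitely complete. A point over $Y$ is a pair $(f\colon A\to Y,\ s\colon Y\to A)$ with $fs=1_Y$. The object $Y$ is a Mal'tsev object if the category of points over $Y$ is unital; explicitly, for all points $(f\colon A\to Y,s)$ and $(g\colon C\to Y,t)$ over $Y$, with pullback $A\times_Y C$ of $f$ and $g$, the morphisms $\langle 1_A,tf\rangle\colon A\to A\times_Y C$ and $\langle sg,1_C\rangle\colon C\to A\times_Y C$ are jointly strongly epimorphic. *)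

theory Defs
  imports Main
begin

record ('o, 'a) cat =
  Ob :: "'o set"
  Ar :: "'a set"
  dm :: "'a \<Rightarrow> 'o"
  cd :: "'a \<Rightarrow> 'o"
  idt :: "'o \<Rightarrow> 'a"
  cmp :: "'a \<Rightarrow> 'a \<Rightarrow> 'a"  (infixl "\<cdot>\<index>" 70)

text \<open>Composition is written in the usual order: \<open>g \<cdot> f\<close> means first \<open>f\<close>, then \<open>g\<close>. It is
  constrained only when \<open>dm g = cd f\<close>; likewise all structure is irrelevant outside \<open>Ob\<close> and \<open>Ar\<close>.\<close>

definition hom :: "('o, 'a) cat \<Rightarrow> 'o \<Rightarrow> 'o \<Rightarrow> 'a set" where
  "hom C A B = {f \<in> Ar C. dm C f = A \<and> cd C f = B}"

locale category =
  fixes C :: "('o, 'a) cat" (structure)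
  assumes dm_Ob: "f \<in> Ar C \<Longrightarrow> dm C f \<in> Ob C"
    and cd_Ob: "f \<in> Ar C \<Longrightarrow> cd C f \<in> Ob C"
    and idt_hom: "A \<in> Ob C \<Longrightarrow> idt C A \<in> hom C A A"
    and cmp_hom: "f \<in> hom C A B \<Longrightarrow> g \<in> hom C B D \<Longrightarrow> g \<cdot> f \<in> hom C A D"
    and idt_left: "f \<in> hom C A B \<Longrightarrow> idt C B \<cdot> f = f"
    and idt_right: "f \<in> hom C A B \<Longrightarrow> f \<cdot> idt C A = f"
    and cmp_assoc: "f \<in> hom C A B \<Longrightarrow> g \<in> hom C B D \<Longrightarrow> h \<in> hom C D E
      \<Longrightarrow> (h \<cdot> g) \<cdot> f = h \<cdot> (g \<cdot> f)"

definition diagram ::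
  "('i, 'j) cat \<Rightarrow> ('o, 'a) cat \<Rightarrow> ('i \<Rightarrow> 'o) \<Rightarrow> ('j \<Rightarrow> 'a) \<Rightarrow> bool" where
  "diagram J C F\<^sub>o F\<^sub>a \<longleftrightarrow>
    (\<forall>j\<in>Ob J. F\<^sub>o j \<in> Ob C) \<and>
    (\<forall>u\<in>Ar J. F\<^sub>a u \<in> hom C (F\<^sub>o (dm J u)) (F\<^sub>o (cd J u))) \<and>
    (\<forall>j\<in>Ob J. F\<^sub>a (idt J j) = idt C (F\<^sub>o j)) \<and>
    (\<forall>u\<in>Ar J. \<forall>v\<in>Ar J. dm J v = cd J u \<longrightarrow> F\<^sub>a (v \<cdot>\<^bsub>J\<^esub> u) = F\<^sub>a v \<cdot>\<^bsub>C\<^esub> F\<^sub>a u)"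

definition cone ::
  "('i, 'j) cat \<Rightarrow> ('o, 'a) cat \<Rightarrow> ('i \<Rightarrow> 'o) \<Rightarrow> ('j \<Rightarrow> 'a) \<Rightarrow> 'o \<Rightarrow> ('i \<Rightarrow> 'a) \<Rightarrow> bool" where
  "cone J C F\<^sub>o F\<^sub>a L p \<longleftrightarrow>
    L \<in> Ob C \<and> (\<forall>j\<in>Ob J. p j \<in> hom C L (F\<^sub>o j)) \<and>
    (\<forall>u\<in>Ar J. F\<^sub>a u \<cdot>\<^bsub>C\<^esub> p (dm J u) = p (cd J u))"

definition limit_cone ::
  "('i, 'j) cat \<Rightarrow> ('o, 'a) cat \<Rightarrow> ('i \<Rightarrow> 'o) \<Rightarrow> ('j \<Rightarrow> 'a) \<Rightarrow> 'o \<Rightarrow> ('i \<Rightarrow> 'a) \<Rightarrow> bool" where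
  "limit_cone J C F\<^sub>o F\<^sub>a L p \<longleftrightarrow>
    cone J C F\<^sub>o F\<^sub>a L p \<and>
    (\<forall>M q. cone J C F\<^sub>o F\<^sub>a M q \<longrightarrow>
      (\<exists>!h. h \<in> hom C M L \<and> (\<forall>j\<in>Ob J. p j \<cdot>\<^bsub>C\<^esub> h = q j)))"

text \<open>Index categories carried by subsets of \<open>nat\<close> suffice, since every finite category is
  isomorphic to one of this kind.\<close>

definition finitely_complete :: "('o, 'a) cat \<Rightarrow> bool" where
  "finitely_complete C \<longleftrightarrow>
    (\<forall>(J :: (nat, nat) cat) F\<^sub>o F\<^sub>a.
      category J \<and> finite (Ob J) \<and> finite (Ar J) \<and> diagram J C F\<^sub>o F\<^sub>a \<longrightarrow>
      (\<exists>L p. limit_cone J C F\<^sub>o F\<^sub>a L p))"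

definition is_pullback :: "('o, 'a) cat \<Rightarrow> 'a \<Rightarrow> 'a \<Rightarrow> 'o \<Rightarrow> 'a \<Rightarrow> 'a \<Rightarrow> bool" where
  "is_pullback C f g P p q \<longleftrightarrow>
    f \<in> Ar C \<and> g \<in> Ar C \<and> cd C f = cd C g \<and> P \<in> Ob C \<and>
    p \<in> hom C P (dm C f) \<and> q \<in> hom C P (dm C g) \<and> f \<cdot>\<^bsub>C\<^esub> p = g \<cdot>\<^bsub>C\<^esub> q \<and>
    (\<forall>W\<in>Ob C. \<forall>x\<in>hom C W (dm C f). \<forall>y\<in>hom C W (dm C g). f \<cdot>\<^bsub>C\<^esub> x = g \<cdot>\<^bsub>C\<^esub> y \<longrightarrow>
      (\<exists>!h. h \<in> hom C W P \<and> p \<cdot>\<^bsub>C\<^esub> h = x \<and> q \<cdot>\<^bsub>C\<^esub> h = y))"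

definition is_coequalizer :: "('o, 'a) cat \<Rightarrow> 'a \<Rightarrow> 'a \<Rightarrow> 'a \<Rightarrow> bool" where
  "is_coequalizer C u v e \<longleftrightarrow>
    u \<in> Ar C \<and> v \<in> Ar C \<and> e \<in> Ar C \<and>
    dm C u = dm C v \<and> cd C u = cd C v \<and> dm C e = cd C u \<and> e \<cdot>\<^bsub>C\<^esub> u = e \<cdot>\<^bsub>C\<^esub> v \<and>
    (\<forall>W\<in>Ob C. \<forall>h\<in>hom C (dm C e) W. h \<cdot>\<^bsub>C\<^esub> u = h \<cdot>\<^bsub>C\<^esub> v \<longrightarrow>
      (\<exists>!k. k \<in> hom C (cd C e) W \<and> k \<cdot>\<^bsub>C\<^esub> e = h))"

definition regular_epi :: "('o, 'a) cat \<Rightarrow> 'a \<Rightarrow> bool" where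
  "regular_epi C e \<longleftrightarrow> (\<exists>u v. is_coequalizer C u v e)"

locale regular_category = category +
  assumes finite_limits: "finitely_complete C"
    and kernel_pair_coequalizer:
      "is_pullback C f f P p q \<Longrightarrow> \<exists>e. is_coequalizer C p q e"
    and regular_epi_pullback_stable:
      "is_pullback C e g P p q \<Longrightarrow> regular_epi C e \<Longrightarrow> regular_epi C q"

definition is_coproduct :: "('o, 'a) cat \<Rightarrow> 'o \<Rightarrow> 'o \<Rightarrow> 'o \<Rightarrow> 'a \<Rightarrow> 'a \<Rightarrow> bool" where
  "is_coproduct C A B S i j \<longleftrightarrow>
    S \<in> Ob C \<and> i \<in> hom C A S \<and> j \<in> hom C B S \<and>
    (\<forall>W\<in>Ob C. \<forall>x\<in>hom C A W. \<forall>y\<in>hom C B W.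
      (\<exists>!h. h \<in> hom C S W \<and> h \<cdot>\<^bsub>C\<^esub> i = x \<and> h \<cdot>\<^bsub>C\<^esub> j = y))"

definition has_binary_coproducts :: "('o, 'a) cat \<Rightarrow> bool" where
  "has_binary_coproducts C \<longleftrightarrow>
    (\<forall>A\<in>Ob C. \<forall>B\<in>Ob C. \<exists>S i j. is_coproduct C A B S i j)"

definition monic :: "('o, 'a) cat \<Rightarrow> 'a \<Rightarrow> bool" where
  "monic C m \<longleftrightarrow> m \<in> Ar C \<and>
    (\<forall>W\<in>Ob C. \<forall>h\<in>hom C W (dm C m). \<forall>k\<in>hom C W (dm C m).
      m \<cdot>\<^bsub>C\<^esub> h = m \<cdot>\<^bsub>C\<^esub> k \<longrightarrow> h = k)"

definition is_relation :: "('o, 'a) cat \<Rightarrow> 'o \<Rightarrow> 'o \<Rightarrow> 'o \<Rightarrow> 'a \<Rightarrow> 'a \<Rightarrow> bool" where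
  "is_relation C X Z R r\<^sub>1 r\<^sub>2 \<longleftrightarrow>
    X \<in> Ob C \<and> Z \<in> Ob C \<and> R \<in> Ob C \<and> r\<^sub>1 \<in> hom C R X \<and> r\<^sub>2 \<in> hom C R Z \<and>
    (\<forall>W\<in>Ob C. \<forall>h\<in>hom C W R. \<forall>k\<in>hom C W R.
      r\<^sub>1 \<cdot>\<^bsub>C\<^esub> h = r\<^sub>1 \<cdot>\<^bsub>C\<^esub> k \<and> r\<^sub>2 \<cdot>\<^bsub>C\<^esub> h = r\<^sub>2 \<cdot>\<^bsub>C\<^esub> k \<longrightarrow> h = k)"

definition in_rel :: "('o, 'a) cat \<Rightarrow> 'o \<Rightarrow> 'o \<Rightarrow> 'a \<Rightarrow> 'a \<Rightarrow> 'a \<Rightarrow> 'a \<Rightarrow> bool" where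
  "in_rel C Y R r\<^sub>1 r\<^sub>2 x z \<longleftrightarrow> (\<exists>w\<in>hom C Y R. r\<^sub>1 \<cdot>\<^bsub>C\<^esub> w = x \<and> r\<^sub>2 \<cdot>\<^bsub>C\<^esub> w = z)"

definition W_maltsev_object :: "('o, 'a) cat \<Rightarrow> 'o \<Rightarrow> bool" where
  "W_maltsev_object C Y \<longleftrightarrow> Y \<in> Ob C \<and>
    (\<forall>X Z R r\<^sub>1 r\<^sub>2. is_relation C X Z R r\<^sub>1 r\<^sub>2 \<longrightarrow>
      (\<forall>x\<^sub>1\<in>hom C Y X. \<forall>x\<^sub>2\<in>hom C Y X. \<forall>z\<^sub>1\<in>hom C Y Z. \<forall>z\<^sub>2\<in>hom C Y Z.
        in_rel C Y R r\<^sub>1 r\<^sub>2 x\<^sub>1 z\<^sub>2 \<and> in_rel C Y R r\<^sub>1 r\<^sub>2 x\<^sub>2 z\<^sub>2 \<and> in_rel C Y R r\<^sub>1 r\<^sub>2 x\<^sub>2 z\<^sub>1 \<longrightarrow>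
        in_rel C Y R r\<^sub>1 r\<^sub>2 x\<^sub>1 z\<^sub>1))"

text \<open>A cospan \<open>A \<rightarrow> P \<leftarrow> D\<close> is jointly strongly epimorphic if it is jointly epimorphic and has
  the diagonal fill-in property against monomorphisms.\<close>

definition jointly_epic :: "('o, 'a) cat \<Rightarrow> 'o \<Rightarrow> 'a \<Rightarrow> 'a \<Rightarrow> bool" where
  "jointly_epic C P u v \<longleftrightarrow>
    u \<in> Ar C \<and> v \<in> Ar C \<and> cd C u = P \<and> cd C v = P \<and>
    (\<forall>W\<in>Ob C. \<forall>h\<in>hom C P W. \<forall>k\<in>hom C P W.
      h \<cdot>\<^bsub>C\<^esub> u = k \<cdot>\<^bsub>C\<^esub> u \<and> h \<cdot>\<^bsub>C\<^esub> v = k \<cdot>\<^bsub>C\<^esub> v \<longrightarrow> h = k)"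

definition jointly_strongly_epic :: "('o, 'a) cat \<Rightarrow> 'o \<Rightarrow> 'a \<Rightarrow> 'a \<Rightarrow> bool" where
  "jointly_strongly_epic C P u v \<longleftrightarrow> jointly_epic C P u v \<and>
    (\<forall>m n a b. monic C m \<and> n \<in> hom C P (cd C m) \<and>
        a \<in> hom C (dm C u) (dm C m) \<and> b \<in> hom C (dm C v) (dm C m) \<and>
        m \<cdot>\<^bsub>C\<^esub> a = n \<cdot>\<^bsub>C\<^esub> u \<and> m \<cdot>\<^bsub>C\<^esub> b = n \<cdot>\<^bsub>C\<^esub> v \<longrightarrow>
      (\<exists>d\<in>hom C P (dm C m). m \<cdot>\<^bsub>C\<^esub> d = n \<and> d \<cdot>\<^bsub>C\<^esub> u = a \<and> d \<cdot>\<^bsub>C\<^esub> v = b))"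

definition is_point :: "('o, 'a) cat \<Rightarrow> 'o \<Rightarrow> 'o \<Rightarrow> 'a \<Rightarrow> 'a \<Rightarrow> bool" where
  "is_point C Y A f s \<longleftrightarrow>
    A \<in> Ob C \<and> f \<in> hom C A Y \<and> s \<in> hom C Y A \<and> f \<cdot>\<^bsub>C\<^esub> s = idt C Y"

text \<open>Pullbacks are only unique up to isomorphism, so the condition is required for every choice
  of \<open>P = A \<times>\<^sub>Y D\<close>; \<open>e\<^sub>1\<close> and \<open>e\<^sub>2\<close> are the induced morphisms \<open>\<langle>1, t f\<rangle>\<close> and \<open>\<langle>s g, 1\<rangle>\<close>.\<close>

definition maltsev_object :: "('o, 'a) cat \<Rightarrow> 'o \<Rightarrow> bool" where
  "maltsev_object C Y \<longleftrightarrow> Y \<in> Ob C \<and>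
    (\<forall>A f s D g t P p q e\<^sub>1 e\<^sub>2.
      is_point C Y A f s \<and> is_point C Y D g t \<and> is_pullback C f g P p q \<and>
      e\<^sub>1 \<in> hom C A P \<and> p \<cdot>\<^bsub>C\<^esub> e\<^sub>1 = idt C A \<and> q \<cdot>\<^bsub>C\<^esub> e\<^sub>1 = t \<cdot>\<^bsub>C\<^esub> f \<and>
      e\<^sub>2 \<in> hom C D P \<and> p \<cdot>\<^bsub>C\<^esub> e\<^sub>2 = s \<cdot>\<^bsub>C\<^esub> g \<and> q \<cdot>\<^bsub>C\<^esub> e\<^sub>2 = idt C D \<longrightarrow>
      jointly_strongly_epic C P e\<^sub>1 e\<^sub>2)"

end

theory Submission imports Defs begin

text \<open>Let \<open>\<nabla> : Y + Y \<rightarrow> Y\<close> be the codiagonal, split by the second injection \<open>\<iota>\<^sub>2\<close>, and let \<open>P\<close> be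
  its kernel pair, with projections \<open>p\<close> and \<open>q\<close>. Since \<open>Y\<close> is a Mal'tsev object,
  \<open>\<langle>1, \<iota>\<^sub>2 \<nabla>\<rangle>\<close> and \<open>\<langle>\<iota>\<^sub>2 \<nabla>, 1\<rangle>\<close> are jointly strongly epimorphic. The morphism
  \<open>\<langle>[x\<^sub>1, x\<^sub>2] p, [z\<^sub>1, z\<^sub>2] q\<rangle> : P \<rightarrow> X \<times> Z\<close> restricts along the first of them to the pairs
  \<open>(x\<^sub>1, z\<^sub>2), (x\<^sub>2, z\<^sub>2)\<close> and along the second to \<open>(x\<^sub>2, z\<^sub>1), (x\<^sub>2, z\<^sub>2)\<close>, so both restrictions, and
  hence the morphism itself, factor through the monomorphism \<open>R \<rightarrow> X \<times> Z\<close>. Precomposing with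
  \<open>\<langle>\<iota>\<^sub>1, \<iota>\<^sub>1\<rangle> : Y \<rightarrow> P\<close> gives \<open>(x\<^sub>1, z\<^sub>1) \<in> R\<close>.\<close>

text \<open>Limits over this shape are binary products. The only composable pairs consist of an
  identity with itself, so \<open>cmp\<close> may return either argument.\<close>

definition discrete_pair :: "(nat, nat) cat" where
  "discrete_pair = \<lparr>Ob = {0, 1}, Ar = {0, 1}, dm = id, cd = id, idt = id, cmp = (\<lambda>v u. u)\<rparr>"

text \<open>The arrows \<open>0\<close>, \<open>1\<close>, \<open>2\<close> are the identities; the others are \<open>3 : 0 \<rightarrow> 2\<close> and \<open>4 : 1 \<rightarrow> 2\<close>.\<close>

definition walking_cospan :: "(nat, nat) cat" where
  "walking_cospan = \<lparr>Ob = {0, 1, 2}, Ar = {0, 1, 2, 3, 4},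
    dm = (\<lambda>u. if u = 3 then 0 else if u = 4 then 1 else u),
    cd = (\<lambda>u. if u = 3 \<or> u = 4 then 2 else u),
    idt = id, cmp = (\<lambda>v u. if u \<le> 2 then v else u)\<rparr>"

lemma category_discrete_pair: "category discrete_pair"
  by unfold_locales (auto simp: discrete_pair_def hom_def)

lemma category_walking_cospan: "category walking_cospan"
  by unfold_locales (auto simp: walking_cospan_def hom_def split: if_splits)

definition is_product :: "('o, 'a) cat \<Rightarrow> 'o \<Rightarrow> 'o \<Rightarrow> 'o \<Rightarrow> 'a \<Rightarrow> 'a \<Rightarrow> bool" where
  "is_product C A B P p q \<longleftrightarrow>
    P \<in> Ob C \<and> p \<in> hom C P A \<and> q \<in> hom C P B \<and>
    (\<forall>W\<in>Ob C. \<forall>x\<in>hom C W A. \<forall>y\<in>hom C W B.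
      (\<exists>!h. h \<in> hom C W P \<and> p \<cdot>\<^bsub>C\<^esub> h = x \<and> q \<cdot>\<^bsub>C\<^esub> h = y))"

context category
begin

lemma product_exists:
  assumes "finitely_complete C" and A: "A \<in> Ob C" and B: "B \<in> Ob C"
  shows "\<exists>P p q. is_product C A B P p q"
proof -
  let ?o = "\<lambda>j::nat. if j = 0 then A else B"
  let ?a = "\<lambda>j. idt C (?o j)"
  have "diagram discrete_pair C ?o ?a"
    using A B idt_hom by (auto simp: diagram_def discrete_pair_def intro!: idt_left[symmetric])
  moreover have "finite (Ob discrete_pair)" "finite (Ar discrete_pair)"
    by (simp_all add: discrete_pair_def)
  ultimately obtain L p where L: "limit_cone discrete_pair C ?o ?a L p"
    using assms(1) category_discrete_pair unfolding finitely_complete_def by blast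
  have cone_iff: "cone discrete_pair C ?o ?a M q \<longleftrightarrow>
      M \<in> Ob C \<and> q 0 \<in> hom C M A \<and> q 1 \<in> hom C M B" for M q
    by (auto simp: cone_def discrete_pair_def idt_left)
  have "\<exists>!h. h \<in> hom C W L \<and> p 0 \<cdot> h = x \<and> p 1 \<cdot> h = y"
    if "W \<in> Ob C" "x \<in> hom C W A" "y \<in> hom C W B" for W x y
  proof -
    let ?q = "\<lambda>j::nat. if j = 0 then x else y"
    have "cone discrete_pair C ?o ?a W ?q"
      using that cone_iff by simp
    then have "\<exists>!h. h \<in> hom C W L \<and> (\<forall>j\<in>Ob discrete_pair. p j \<cdot> h = ?q j)"
      using L unfolding limit_cone_def by blast
    then show ?thesis by (simp add: discrete_pair_def)
  qed
  then have "is_product C A B L (p 0) (p 1)"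
    using L cone_iff unfolding is_product_def limit_cone_def by simp
  then show ?thesis by blast
qed

lemma pullback_exists:
  assumes "finitely_complete C" and f: "f \<in> hom C A D" and g: "g \<in> hom C B D"
  shows "\<exists>P p q. is_pullback C f g P p q"
proof -
  have Ob: "A \<in> Ob C" "B \<in> Ob C" "D \<in> Ob C"
    using f g dm_Ob cd_Ob by (auto simp: hom_def)
  let ?o = "\<lambda>j::nat. if j = 0 then A else if j = 1 then B else D"
  let ?a = "\<lambda>u::nat. if u = 3 then f else if u = 4 then g else idt C (?o u)"
  have "diagram walking_cospan C ?o ?a"
    using Ob f g idt_hom idt_left[OF idt_hom] idt_left[OF f] idt_left[OF g]
      idt_right[OF f] idt_right[OF g]
    by (auto simp: diagram_def walking_cospan_def)
  moreover have "finite (Ob walking_cospan)" "finite (Ar walking_cospan)"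
    by (simp_all add: walking_cospan_def)
  ultimately obtain L p where L: "limit_cone walking_cospan C ?o ?a L p"
    using assms(1) category_walking_cospan unfolding finitely_complete_def by blast
  have cone_iff: "cone walking_cospan C ?o ?a M q \<longleftrightarrow> M \<in> Ob C \<and> q 0 \<in> hom C M A \<and>
      q 1 \<in> hom C M B \<and> q 2 \<in> hom C M D \<and> f \<cdot> q 0 = q 2 \<and> g \<cdot> q 1 = q 2" for M q
    by (auto simp: cone_def walking_cospan_def idt_left)
  have "\<exists>!h. h \<in> hom C W L \<and> p 0 \<cdot> h = x \<and> p 1 \<cdot> h = y"
    if W: "W \<in> Ob C" "x \<in> hom C W A" "y \<in> hom C W B" "f \<cdot> x = g \<cdot> y" for W x y
  proof -
    let ?q = "\<lambda>j::nat. if j = 0 then x else if j = 1 then y else f \<cdot> x"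
    have "cone walking_cospan C ?o ?a W ?q"
      using W cmp_hom[OF W(2) f] cone_iff by simp
    then have ex1: "\<exists>!h. h \<in> hom C W L \<and> (\<forall>j\<in>Ob walking_cospan. p j \<cdot> h = ?q j)"
      using L unfolding limit_cone_def by blast
    \<comment> \<open>A cone over the cospan has a third leg, into \<open>D\<close>, but it is
      forced to be \<open>f\<close> after the leg into \<open>A\<close>. Hence unique existence for
      three legs yields it for the two legs of a pullback.\<close>
    have p2: "p 2 \<cdot> h = f \<cdot> x" if "h \<in> hom C W L" "p 0 \<cdot> h = x" for h
    proof -
      have p: "p 0 \<in> hom C L A" "f \<cdot> p 0 = p 2"
        using L unfolding limit_cone_def cone_iff by blast+
      show ?thesis using cmp_assoc[OF that(1) p(1) f] p(2) that(2) by simp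
    qed
    from ex1 have "\<exists>!h. (h \<in> hom C W L \<and> p 0 \<cdot> h = x \<and> p 1 \<cdot> h = y) \<and> p 2 \<cdot> h = f \<cdot> x"
      by (simp add: walking_cospan_def)
    then show ?thesis using p2 by blast
  qed
  moreover have "f \<in> Ar C" "g \<in> Ar C" "dm C f = A" "dm C g = B" "cd C f = D" "cd C g = D"
    using f g by (simp_all add: hom_def)
  ultimately have "is_pullback C f g L (p 0) (p 1)"
    using L unfolding is_pullback_def limit_cone_def cone_iff by simp
  then show ?thesis by blast
qed

lemma product_hom_ext:
  assumes "is_product C A B P p q" "h \<in> hom C W P" "k \<in> hom C W P"
    and "p \<cdot> h = p \<cdot> k" "q \<cdot> h = q \<cdot> k"
  shows "h = k"
proof -
  have "W \<in> Ob C" using assms(2) dm_Ob by (auto simp: hom_def)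
  moreover have "p \<cdot> k \<in> hom C W A" "q \<cdot> k \<in> hom C W B"
    using assms(1,3) cmp_hom unfolding is_product_def by blast+
  ultimately show ?thesis using assms unfolding is_product_def by blast
qed

lemma coproduct_hom_ext:
  assumes "is_coproduct C A B S i j" "h \<in> hom C S W" "k \<in> hom C S W"
    and "h \<cdot> i = k \<cdot> i" "h \<cdot> j = k \<cdot> j"
  shows "h = k"
proof -
  have "W \<in> Ob C" using assms(2) cd_Ob by (auto simp: hom_def)
  moreover have "k \<cdot> i \<in> hom C A W" "k \<cdot> j \<in> hom C B W"
    using assms(1,3) cmp_hom unfolding is_coproduct_def by blast+
  ultimately show ?thesis using assms unfolding is_coproduct_def by blast
qed

text \<open>Projecting \<open>m h = m k\<close> to \<open>X\<close> and \<open>Z\<close> gives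
  equality along both legs, which are jointly monic. Thus the fill-in property, stated for a single
  monomorphism, applies to relations.\<close>

lemma monic_pairing:
  assumes P: "is_product C X Z P p q" and R: "is_relation C X Z R r\<^sub>1 r\<^sub>2"
    and m: "m \<in> hom C R P" "p \<cdot> m = r\<^sub>1" "q \<cdot> m = r\<^sub>2"
  shows "monic C m"
  unfolding monic_def
proof (intro conjI ballI impI)
  show "m \<in> Ar C" using m by (simp add: hom_def)
next
  fix W h k
  assume W: "W \<in> Ob C" and "h \<in> hom C W (dm C m)" "k \<in> hom C W (dm C m)"
    and eq: "m \<cdot> h = m \<cdot> k"
  then have hk: "h \<in> hom C W R" "k \<in> hom C W R" using m by (auto simp: hom_def)
  have pq: "p \<in> hom C P X" "q \<in> hom C P Z" using P by (auto simp: is_product_def)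
  have "r\<^sub>1 \<cdot> h = r\<^sub>1 \<cdot> k" "r\<^sub>2 \<cdot> h = r\<^sub>2 \<cdot> k"
    using cmp_assoc[OF hk(1) m(1)] cmp_assoc[OF hk(2) m(1)] pq eq m by metis+
  then show "h = k" using R W hk unfolding is_relation_def by blast
qed

lemma maltsev_imp_W_maltsev:
  assumes lim: "finitely_complete C" and coprod: "has_binary_coproducts C"
    and maltsev: "maltsev_object C Y"
  shows "W_maltsev_object C Y"
proof -
  have Y: "Y \<in> Ob C" using maltsev by (simp add: maltsev_object_def)
  obtain S i j where S: "is_coproduct C Y Y S i j"
    using coprod Y unfolding has_binary_coproducts_def by blast
  then have S_Ob: "S \<in> Ob C" and i: "i \<in> hom C Y S" and j: "j \<in> hom C Y S"
    by (auto simp: is_coproduct_def)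
  have copair: "\<exists>h \<in> hom C S W. h \<cdot> i = x \<and> h \<cdot> j = y"
    if "x \<in> hom C Y W" "y \<in> hom C Y W" for W x y
  proof -
    have "W \<in> Ob C" using that(1) cd_Ob by (auto simp: hom_def)
    then show ?thesis using S that unfolding is_coproduct_def by blast
  qed
  \<comment> \<open>\<open>f\<close> is the codiagonal; both injections split it, and
    \<open>j\<close> will serve as the section.\<close>
  obtain f where f: "f \<in> hom C S Y" "f \<cdot> i = idt C Y" "f \<cdot> j = idt C Y"
    using copair[OF idt_hom idt_hom] Y by blast
  obtain P p q where P: "is_pullback C f f P p q"
    using pullback_exists[OF lim f(1) f(1)] by blast
  then have p: "p \<in> hom C P S" and q: "q \<in> hom C P S"
    using f by (auto simp: is_pullback_def hom_def)
  have pb: "\<exists>h \<in> hom C W P. p \<cdot> h = x \<and> q \<cdot> h = y"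
    if "x \<in> hom C W S" "y \<in> hom C W S" "f \<cdot> x = f \<cdot> y" for W x y
  proof -
    have "W \<in> Ob C" "dm C f = S" using that(1) f(1) dm_Ob by (auto simp: hom_def)
    then show ?thesis using P that unfolding is_pullback_def by blast
  qed
  note idS = idt_hom[OF S_Ob]
  have jf: "j \<cdot> f \<in> hom C S S" using cmp_hom f j by blast
  \<comment> \<open>Since \<open>f j = 1\<close>, the pairs \<open>(1, j f)\<close> and
    \<open>(j f, 1)\<close> both factor through the kernel pair \<open>P\<close> of
    \<open>f\<close>.\<close>
  have f_jf: "f \<cdot> (j \<cdot> f) = f \<cdot> idt C S"
    using cmp_assoc[OF f(1) j f(1)] f idt_left[OF f(1)] idt_right[OF f(1)] by simp
  obtain e\<^sub>1 where e\<^sub>1: "e\<^sub>1 \<in> hom C S P" "p \<cdot> e\<^sub>1 = idt C S" "q \<cdot> e\<^sub>1 = j \<cdot> f"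
    using pb[OF idS jf f_jf[symmetric]] by blast
  obtain e\<^sub>2 where e\<^sub>2: "e\<^sub>2 \<in> hom C S P" "p \<cdot> e\<^sub>2 = j \<cdot> f" "q \<cdot> e\<^sub>2 = idt C S"
    using pb[OF jf idS f_jf] by blast
  obtain d where d: "d \<in> hom C Y P" "p \<cdot> d = i" "q \<cdot> d = i"
    using pb[OF i i] by blast
  \<comment> \<open>This one point is used for both points in \<open>maltsev_object\<close>.\<close>
  have "is_point C Y S f j"
    using S_Ob f j by (simp add: is_point_def)
  then have strong: "jointly_strongly_epic C P e\<^sub>1 e\<^sub>2"
    using maltsev P e\<^sub>1 e\<^sub>2 unfolding maltsev_object_def by blast
  \<comment> \<open>\<open>j f\<close> sends both injections to \<open>j\<close>, so a copairing
    precomposed with it sees only its second component.\<close>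
  have jf_i: "(j \<cdot> f) \<cdot> i = j" and jf_j: "(j \<cdot> f) \<cdot> j = j"
    using cmp_assoc[OF i f(1) j] cmp_assoc[OF j f(1) j] f idt_right[OF j] by simp_all
  have "in_rel C Y R r\<^sub>1 r\<^sub>2 x\<^sub>1 z\<^sub>1"
    if R: "is_relation C X Z R r\<^sub>1 r\<^sub>2"
      and x: "x\<^sub>1 \<in> hom C Y X" "x\<^sub>2 \<in> hom C Y X" and z: "z\<^sub>1 \<in> hom C Y Z" "z\<^sub>2 \<in> hom C Y Z"
      and rel: "in_rel C Y R r\<^sub>1 r\<^sub>2 x\<^sub>1 z\<^sub>2" "in_rel C Y R r\<^sub>1 r\<^sub>2 x\<^sub>2 z\<^sub>2" "in_rel C Y R r\<^sub>1 r\<^sub>2 x\<^sub>2 z\<^sub>1"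
    for X Z R r\<^sub>1 r\<^sub>2 x\<^sub>1 x\<^sub>2 z\<^sub>1 z\<^sub>2
  proof -
    have XZ: "X \<in> Ob C" "Z \<in> Ob C" "R \<in> Ob C" and r: "r\<^sub>1 \<in> hom C R X" "r\<^sub>2 \<in> hom C R Z"
      using R by (auto simp: is_relation_def)
    obtain Q \<pi>\<^sub>1 \<pi>\<^sub>2 where Q: "is_product C X Z Q \<pi>\<^sub>1 \<pi>\<^sub>2"
      using product_exists[OF lim XZ(1,2)] by blast
    then have \<pi>: "\<pi>\<^sub>1 \<in> hom C Q X" "\<pi>\<^sub>2 \<in> hom C Q Z" by (auto simp: is_product_def)
    obtain m where m: "m \<in> hom C R Q" "\<pi>\<^sub>1 \<cdot> m = r\<^sub>1" "\<pi>\<^sub>2 \<cdot> m = r\<^sub>2"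
      using Q XZ r unfolding is_product_def by blast
    obtain x where xx: "x \<in> hom C S X" "x \<cdot> i = x\<^sub>1" "x \<cdot> j = x\<^sub>2"
      using copair[OF x] by blast
    obtain z where zz: "z \<in> hom C S Z" "z \<cdot> i = z\<^sub>1" "z \<cdot> j = z\<^sub>2"
      using copair[OF z] by blast
    have xp: "x \<cdot> p \<in> hom C P X" and zq: "z \<cdot> q \<in> hom C P Z"
      using cmp_hom xx zz p q by blast+
    have "P \<in> Ob C" using P by (simp add: is_pullback_def)
    then obtain n where n: "n \<in> hom C P Q" "\<pi>\<^sub>1 \<cdot> n = x \<cdot> p" "\<pi>\<^sub>2 \<cdot> n = z \<cdot> q"
      using Q xp zq unfolding is_product_def by blast
    \<comment> \<open>This treats \<open>e\<^sub>1\<close> and \<open>e\<^sub>2\<close> at once: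
      \<open>u\<close> and \<open>v\<close> are the components of \<open>e\<close>. As
      \<open>S\<close> is a coproduct, membership in \<open>R\<close> need only be tested on the two
      injections.\<close>
    have restrict: "\<exists>a \<in> hom C S R. m \<cdot> a = n \<cdot> e"
      if e: "e \<in> hom C S P" and u: "p \<cdot> e = u" "u \<in> hom C S S" and v: "q \<cdot> e = v" "v \<in> hom C S S"
        and uv: "in_rel C Y R r\<^sub>1 r\<^sub>2 (x \<cdot> (u \<cdot> i)) (z \<cdot> (v \<cdot> i))"
          "in_rel C Y R r\<^sub>1 r\<^sub>2 (x \<cdot> (u \<cdot> j)) (z \<cdot> (v \<cdot> j))"
      for e u v
    proof -
      obtain b c where b: "b \<in> hom C Y R" "r\<^sub>1 \<cdot> b = x \<cdot> (u \<cdot> i)" "r\<^sub>2 \<cdot> b = z \<cdot> (v \<cdot> i)"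
        and c: "c \<in> hom C Y R" "r\<^sub>1 \<cdot> c = x \<cdot> (u \<cdot> j)" "r\<^sub>2 \<cdot> c = z \<cdot> (v \<cdot> j)"
        using uv unfolding in_rel_def by blast
      obtain a where a: "a \<in> hom C S R" "a \<cdot> i = b" "a \<cdot> j = c"
        using copair[OF b(1) c(1)] by blast
      \<comment> \<open>The equation \<open>m a = n e\<close> is checked after each projection of
        \<open>Q\<close>, and there on each injection of \<open>S\<close>.\<close>
      have "r\<^sub>1 \<cdot> a = x \<cdot> u"
      proof (rule coproduct_hom_ext[OF S])
        show "r\<^sub>1 \<cdot> a \<in> hom C S X" "x \<cdot> u \<in> hom C S X"
          using cmp_hom a r xx u by blast+
      qed (use a b c cmp_assoc[OF i] cmp_assoc[OF j] r xx(1) u(2) in metis)+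
      moreover have "r\<^sub>2 \<cdot> a = z \<cdot> v"
      proof (rule coproduct_hom_ext[OF S])
        show "r\<^sub>2 \<cdot> a \<in> hom C S Z" "z \<cdot> v \<in> hom C S Z"
          using cmp_hom a r zz v by blast+
      qed (use a b c cmp_assoc[OF i] cmp_assoc[OF j] r zz(1) v(2) in metis)+
      moreover have "\<pi>\<^sub>1 \<cdot> (n \<cdot> e) = x \<cdot> u" "\<pi>\<^sub>2 \<cdot> (n \<cdot> e) = z \<cdot> v"
        using cmp_assoc[OF e n(1)] \<pi> n cmp_assoc[OF e p xx(1)] cmp_assoc[OF e q zz(1)] u v
        by metis+
      moreover have "\<pi>\<^sub>1 \<cdot> (m \<cdot> a) = r\<^sub>1 \<cdot> a" "\<pi>\<^sub>2 \<cdot> (m \<cdot> a) = r\<^sub>2 \<cdot> a"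
        using cmp_assoc[OF a(1) m(1)] \<pi> m by metis+
      ultimately have "m \<cdot> a = n \<cdot> e"
        using product_hom_ext[OF Q cmp_hom[OF a(1) m(1)] cmp_hom[OF e n(1)]] by simp
      then show ?thesis using a by blast
    qed
    \<comment> \<open>Here \<open>u = 1\<close> and \<open>v = j f\<close>, so the two memberships
      to supply are those of \<open>(x\<^sub>1, z\<^sub>2)\<close> and
      \<open>(x\<^sub>2, z\<^sub>2)\<close>.\<close>
    have "\<exists>a \<in> hom C S R. m \<cdot> a = n \<cdot> e\<^sub>1"
      by (rule restrict[OF e\<^sub>1(1,2) idS e\<^sub>1(3) jf])
        (simp_all add: jf_i jf_j idt_left[OF i] idt_left[OF j] xx zz rel)
    moreover have "\<exists>a \<in> hom C S R. m \<cdot> a = n \<cdot> e\<^sub>2"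
      by (rule restrict[OF e\<^sub>2(1,2) jf e\<^sub>2(3) idS])
        (simp_all add: jf_i jf_j idt_left[OF i] idt_left[OF j] xx zz rel)
    moreover have "dm C m = R" "cd C m = Q" "dm C e\<^sub>1 = S" "dm C e\<^sub>2 = S"
      using m e\<^sub>1 e\<^sub>2 by (auto simp: hom_def)
    \<comment> \<open>\<open>k\<close> is the diagonal filler for \<open>n\<close> against the
      monomorphism \<open>m\<close>.\<close>
    ultimately obtain k where k: "k \<in> hom C P R" "m \<cdot> k = n"
      using strong monic_pairing[OF Q R m] n(1) unfolding jointly_strongly_epic_def by metis
    have "r\<^sub>1 \<cdot> k = x \<cdot> p" "r\<^sub>2 \<cdot> k = z \<cdot> q"
      using cmp_assoc[OF k(1) m(1)] \<pi> m k n by metis+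
    \<comment> \<open>Both projections of \<open>d\<close> are \<open>i\<close>, and
      \<open>x i = x\<^sub>1\<close>, \<open>z i = z\<^sub>1\<close>; so \<open>k d\<close>
      witnesses the desired membership.\<close>
    then have "r\<^sub>1 \<cdot> (k \<cdot> d) = x\<^sub>1" "r\<^sub>2 \<cdot> (k \<cdot> d) = z\<^sub>1"
      using cmp_assoc[OF d(1) k(1)] r cmp_assoc[OF d(1) p xx(1)] cmp_assoc[OF d(1) q zz(1)] d xx zz
      by metis+
    then show ?thesis using cmp_hom[OF d(1) k(1)] unfolding in_rel_def by blast
  qed
  then show ?thesis using Y unfolding W_maltsev_object_def by blast
qed

end

theorem proposition1p4:
  fixes C :: "('o, 'a) cat" and Y :: 'o
  assumes "regular_category C"
    and "has_binary_coproducts C"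
    and "Y \<in> Ob C"
    and "maltsev_object C Y"
  shows "W_maltsev_object C Y"
proof -
  interpret regular_category C by fact
  show ?thesis using maltsev_imp_W_maltsev finite_limits assms(2,4) by blast
qed

end
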